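(* Consider equations $\forall \bar x.\ p_1(\bar x)=p_2(\bar x)$ between functional programs built from canonical structural recursions (CSRs), constructors and primitive operators, as defined in the context. Both of the following forms of equations are induction-friendly. (F1) Equations $f\ v_1\ \ldots\ v_k = p(v_1,\ldots,v_k)$ such that: (F1.1) one side of the equation is of the form $f\ v_1\ldots v_k$, where $f$ is a CSR and $v_1,\ldots,v_k$ are pairwise different variables (so $f$ pattern-matches on $v_k$); and (F1.2) the other side is a program $p(v_1,\ldots,v_k)$ such that, if $v_k$ appears in $p$, then there exists an occurrence of $v_k$ in $p$ such that (1) $v_k$ appears as the recursive argument of the CSR it is passed to, and (2) all other arguments in this CSR invocation do not contain $v_k$. (F2) Equations $f\ v_1\ \ldots\ v_k = f'\ v_1'\ \ldots\ v_k'$, where $f,f'$ are CSRs and $v_i\neq v_j$ and $v_i'\neq v_j'$ for all $1\le i<j\le k$, i.e. each side is a single CSR call whose arguments are distinct variables. That is, for every equation of form (F1) and for every equation of form (F2), there exists a variable such that performing induction on it yields an effective application of the inductive hypothesis in the cases involving a recursive substructure (for (F2), the induction is a nested induction over $v_k$ and $v_k'$).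
   Context: Types and programs. There is one built-in type $\mathtt{Int}$ and one algebraic data type $\mathtt{List}$ with constructors $\mathtt{nil}:\mathtt{List}$ and $\mathtt{cons}:\mathtt{Int}\to\mathtt{List}\to\mathtt{List}$. Programs are the well-typed terms generated from variables, integer constants, applications of primitive operators on $\mathtt{Int}$, applications of constructors, and applications of CSRs. We write $p(v_1,\ldots,v_k)$ for a program whose free variables are among $v_1,\ldots,v_k$. A canonical structural recursion (CSR) $f$ with $k$ arguments is a function whose last argument, called the recursive argument, has type $\mathtt{List}$, and which is given by two programs $base(v_1,\ldots,v_{k-1})$ and $comb(v_1,\ldots,v_{k-1},h,r)$ (which may use previously defined CSRs) via $$f\ v_1\ldots v_{k-1}\ \mathtt{nil} = base(v_1,\ldots,v_{k-1}),$$ $$f\ v_1\ldots v_{k-1}\ (\mathtt{cons}\ h\ t) = comb(v_1,\ldots,v_{k-1},h,\,f\ v_1\ldots v_{k-1}\ t).$$ Thus the arguments other than the last are unchanged in the recursive call. Term reduction is a single-step evaluation by one of the rules: $f\ p_1\ldots p_{k-1}\ \mathtt{nil}\to base(p_1,\ldots,p_{k-1})$; $f\ p_1\ldots p_{k-1}\ (\mathtt{cons}\ p_h\ p_t)\to comb(p_1,\ldots,p_{k-1},p_h,f\ p_1\ldots p_{k-1}\ p_t)$; and $op\ c_1\ldots c_l\to c^*$ for a primitive operator $op$ applied to constants, where $c^*$ is the computed value. Induction. Performing (structural) induction on a $\mathtt{List}$ variable $x$ of an equation $e$ produces a case $x=\mathtt{nil}$ and a case $x=\mathtt{cons}\ h\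 t$ with fresh $h,t$. The latter is the case involving a recursive substructure; its proof goal is $e$ with $x$ replaced by $\mathtt{cons}\ h\ t$, and its inductive hypothesis is $e$ with $x$ replaced by $t$. A nested induction over two variables performs induction on the first and then, in the resulting $\mathtt{cons}$-case goal (after reduction and rewriting by the first inductive hypothesis), induction on the second. Effective application. An effective application of the inductive hypothesis consists of two steps: after term reductions of the goal, (i) the inductive hypothesis is used to rewrite the equation (a subterm of the goal matches one side of the hypothesis and is replaced by the other side), and (ii) generalization is then used to eliminate a common non-leaf subprogram, i.e. some non-leaf subprogram occurs on both sides of the resulting equation and is replaced by a fresh variable. A form (class) of equations is induction-friendly if, for every equation in this form, there exists a variable such that performing induction on it yields an effective application of the inductive hypothesis for the cases involving a recursive substructure.
   Formalization: The CSRs f (F1, F2), f' (F2) and the CSR receiving v_k in F1.2 are required to actually use the recursive result r in comb; without this the claim fails, e.g. head x = head x with head nil = 0, head (cons h t) = h. *)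

theory Defs
  imports Main
begin

datatype ty = TInt | TList

text \<open>
  The variable type is a parameter, so that the defining programs of a CSR can range over its
  formal parameters while equations range over names. A CSR is referred to by its position in
  the list of CSR definitions; the recursive argument of a call is the last one.
\<close>

datatype (dead 'o, vars: 'v) prog =
    Var 'v
  | Const int
  | Op 'o "('o, 'v) prog list"
  | PNil
  | PCons "('o, 'v) prog" "('o, 'v) prog"
  | Call nat "('o, 'v) prog list"

text \<open>
  \<open>Arg i\<close> is the i-th non-recursive argument (counted from 0), \<open>Head\<close> is h and \<open>Rec\<close> is r
  in \<open>comb(v_1, ..., v_{k-1}, h, r)\<close>.
\<close>

datatype comb_var = Arg nat | Head | Rec

text \<open>\<open>params\<close> lists the types of the k - 1 non-recursive arguments.\<close>

record 'o csr =
  params :: "ty list"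
  result :: ty
  base :: "('o, nat) prog"
  comb :: "('o, comb_var) prog"

record 'o language =
  op_arity :: "'o \<Rightarrow> nat"
  op_sem :: "'o \<Rightarrow> int list \<Rightarrow> int"
  csrs :: "'o csr list"

inductive has_type :: "'o language \<Rightarrow> ('v \<rightharpoonup> ty) \<Rightarrow> ('o, 'v) prog \<Rightarrow> ty \<Rightarrow> bool"
  for L :: "'o language" and \<Gamma> :: "'v \<rightharpoonup> ty" where
  "\<Gamma> x = Some \<tau> \<Longrightarrow> has_type L \<Gamma> (Var x) \<tau>"
| "has_type L \<Gamma> (Const c) TInt"
| "length ps = op_arity L q \<Longrightarrow> (\<forall>p\<in>set ps. has_type L \<Gamma> p TInt) \<Longrightarrow> has_type L \<Gamma> (Op q ps) TInt"
| "has_type L \<Gamma> PNil TList"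
| "has_type L \<Gamma> p TInt \<Longrightarrow> has_type L \<Gamma> p' TList \<Longrightarrow> has_type L \<Gamma> (PCons p p') TList"
| "f < length (csrs L) \<Longrightarrow> list_all2 (has_type L \<Gamma>) ps (params (csrs L ! f) @ [TList])
    \<Longrightarrow> has_type L \<Gamma> (Call f ps) (result (csrs L ! f))"

definition base_ctxt :: "'o csr \<Rightarrow> nat \<rightharpoonup> ty" where
  "base_ctxt c = (\<lambda>i. if i < length (params c) then Some (params c ! i) else None)"

definition comb_ctxt :: "'o csr \<Rightarrow> comb_var \<rightharpoonup> ty" where
  "comb_ctxt c = (\<lambda>v. case v of Arg i \<Rightarrow> base_ctxt c i | Head \<Rightarrow> Some TInt | Rec \<Rightarrow> Some (result c))"

text \<open>
  Typing over the truncated list of definitions restricts the defining programs of a CSR to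
  previously defined CSRs; the typing contexts restrict their free variables.
\<close>

definition wf_language :: "'o language \<Rightarrow> bool" where
  "wf_language L \<longleftrightarrow> (\<forall>n<length (csrs L).
     let c = csrs L ! n; L' = L\<lparr>csrs := take n (csrs L)\<rparr>
     in has_type L' (base_ctxt c) (base c) (result c) \<and>
        has_type L' (comb_ctxt c) (comb c) (result c))"

primrec subst :: "('v \<Rightarrow> ('o, 'w) prog) \<Rightarrow> ('o, 'v) prog \<Rightarrow> ('o, 'w) prog" where
  "subst \<sigma> (Var x) = \<sigma> x"
| "subst \<sigma> (Const c) = Const c"
| "subst \<sigma> (Op q ps) = Op q (map (subst \<sigma>) ps)"
| "subst \<sigma> PNil = PNil"
| "subst \<sigma> (PCons p p') = PCons (subst \<sigma> p) (subst \<sigma> p')"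
| "subst \<sigma> (Call f ps) = Call f (map (subst \<sigma>) ps)"

fun args :: "('o, 'v) prog \<Rightarrow> ('o, 'v) prog list" where
  "args (Op q ps) = ps"
| "args (PCons p p') = [p, p']"
| "args (Call f ps) = ps"
| "args _ = []"

abbreviation non_leaf :: "('o, 'v) prog \<Rightarrow> bool" where
  "non_leaf p \<equiv> args p \<noteq> []"

inductive_set subprogs :: "('o, 'v) prog \<Rightarrow> ('o, 'v) prog set" for p where
  "p \<in> subprogs p"
| "q \<in> subprogs p \<Longrightarrow> s \<in> set (args q) \<Longrightarrow> s \<in> subprogs p"

text \<open>Application of a relation at exactly one position inside a program.\<close>

inductive in_context :: "(('o, 'v) prog \<Rightarrow> ('o, 'v) prog \<Rightarrow> bool) \<Rightarrow> ('o, 'v) prog \<Rightarrow> ('o, 'v) prog \<Rightarrow> bool"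
  for R where
  "R p q \<Longrightarrow> in_context R p q"
| "in_context R p q \<Longrightarrow> in_context R (Op a (ps @ p # qs)) (Op a (ps @ q # qs))"
| "in_context R p q \<Longrightarrow> in_context R (PCons p s) (PCons q s)"
| "in_context R p q \<Longrightarrow> in_context R (PCons s p) (PCons s q)"
| "in_context R p q \<Longrightarrow> in_context R (Call f (ps @ p # qs)) (Call f (ps @ q # qs))"

inductive contracts :: "'o language \<Rightarrow> ('o, 'v) prog \<Rightarrow> ('o, 'v) prog \<Rightarrow> bool"
  for L :: "'o language" where
  "f < length (csrs L) \<Longrightarrow> length ps = length (params (csrs L ! f)) \<Longrightarrow>
    contracts L (Call f (ps @ [PNil])) (subst (\<lambda>i. ps ! i) (base (csrs L ! f)))"
| "f < length (csrs L) \<Longrightarrow> length ps = length (params (csrs L ! f)) \<Longrightarrow>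
    contracts L (Call f (ps @ [PCons ph pt]))
      (subst (\<lambda>v. case v of Arg i \<Rightarrow> ps ! i | Head \<Rightarrow> ph | Rec \<Rightarrow> Call f (ps @ [pt]))
        (comb (csrs L ! f)))"
| "length cs = op_arity L q \<Longrightarrow> contracts L (Op q (map Const cs)) (Const (op_sem L q cs))"

type_synonym vname = string

type_synonym 'o equation = "('o, vname) prog \<times> ('o, vname) prog"

definition eq_vars :: "'o equation \<Rightarrow> vname set" where
  "eq_vars e = vars (fst e) \<union> vars (snd e)"

text \<open>The context \<open>\<Gamma>\<close> gives the types of the universally quantified variables.\<close>

definition well_typed :: "'o language \<Rightarrow> (vname \<rightharpoonup> ty) \<Rightarrow> 'o equation \<Rightarrow> bool" where
  "well_typed L \<Gamma> e \<longleftrightarrow> (\<exists>\<tau>. has_type L \<Gamma> (fst e) \<tau> \<and> has_type L \<Gamma> (snd e) \<tau>)"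

definition eq_subst :: "vname \<Rightarrow> ('o, vname) prog \<Rightarrow> 'o equation \<Rightarrow> 'o equation" where
  "eq_subst x p e = (subst (Var(x := p)) (fst e), subst (Var(x := p)) (snd e))"

inductive in_equation ::
  "(('o, vname) prog \<Rightarrow> ('o, vname) prog \<Rightarrow> bool) \<Rightarrow> 'o equation \<Rightarrow> 'o equation \<Rightarrow> bool" for R where
  "in_context R l l' \<Longrightarrow> in_equation R (l, r) (l', r)"
| "in_context R r r' \<Longrightarrow> in_equation R (l, r) (l, r')"

abbreviation reduces :: "'o language \<Rightarrow> 'o equation \<Rightarrow> 'o equation \<Rightarrow> bool" where
  "reduces L \<equiv> in_equation (contracts L)"

text \<open>
  One use of a hypothesis: one occurrence of one of its sides is replaced by the other side. The
  variables of an inductive hypothesis are fixed, so matching is syntactic identity.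
\<close>

definition rewrites_by :: "'o equation \<Rightarrow> 'o equation \<Rightarrow> 'o equation \<Rightarrow> bool" where
  "rewrites_by hyp = in_equation (\<lambda>p q. (p, q) = hyp \<or> (q, p) = hyp)"

primrec replace :: "('o, 'v) prog \<Rightarrow> 'v \<Rightarrow> ('o, 'v) prog \<Rightarrow> ('o, 'v) prog" where
  "replace s z (Var x) = (if Var x = s then Var z else Var x)"
| "replace s z (Const c) = (if Const c = s then Var z else Const c)"
| "replace s z (Op q ps) = (if Op q ps = s then Var z else Op q (map (replace s z) ps))"
| "replace s z PNil = (if PNil = s then Var z else PNil)"
| "replace s z (PCons p p') =
    (if PCons p p' = s then Var z else PCons (replace s z p) (replace s z p'))"
| "replace s z (Call f ps) = (if Call f ps = s then Var z else Call f (map (replace s z) ps))"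

definition generalizes :: "'o equation \<Rightarrow> 'o equation \<Rightarrow> bool" where
  "generalizes e e' \<longleftrightarrow> (\<exists>s z. non_leaf s \<and> s \<in> subprogs (fst e) \<and> s \<in> subprogs (snd e) \<and>
     z \<notin> eq_vars e \<and> e' = (replace s z (fst e), replace s z (snd e)))"

text \<open>The reductions before the rewriting step need not reach a normal form.\<close>

definition effective_application :: "'o language \<Rightarrow> 'o equation \<Rightarrow> 'o equation \<Rightarrow> bool" where
  "effective_application L hyp goal \<longleftrightarrow> (\<exists>g\<^sub>1 g\<^sub>2 g\<^sub>3.
     (reduces L)\<^sup>*\<^sup>* goal g\<^sub>1 \<and> rewrites_by hyp g\<^sub>1 g\<^sub>2 \<and> generalizes g\<^sub>2 g\<^sub>3)"

definition inductable :: "(vname \<rightharpoonup> ty) \<Rightarrow> vname \<Rightarrow> 'o equation \<Rightarrow> bool" where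
  "inductable \<Gamma> x e \<longleftrightarrow> x \<in> eq_vars e \<and> \<Gamma> x = Some TList"

definition fresh_pair :: "vname \<Rightarrow> vname \<Rightarrow> 'o equation \<Rightarrow> bool" where
  "fresh_pair h t e \<longleftrightarrow> h \<notin> eq_vars e \<and> t \<notin> eq_vars e \<and> h \<noteq> t"

abbreviation cons_goal :: "vname \<Rightarrow> vname \<Rightarrow> vname \<Rightarrow> 'o equation \<Rightarrow> 'o equation" where
  "cons_goal x h t \<equiv> eq_subst x (PCons (Var h) (Var t))"

abbreviation ind_hyp :: "vname \<Rightarrow> vname \<Rightarrow> 'o equation \<Rightarrow> 'o equation" where
  "ind_hyp x t \<equiv> eq_subst x (Var t)"

text \<open>
  Only the cons-case is constrained: it is the one involving a recursive substructure.
\<close>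

definition effective_induction ::
  "'o language \<Rightarrow> (vname \<rightharpoonup> ty) \<Rightarrow> vname \<Rightarrow> 'o equation \<Rightarrow> bool" where
  "effective_induction L \<Gamma> x e \<longleftrightarrow> inductable \<Gamma> x e \<and>
     (\<forall>h t. fresh_pair h t e \<longrightarrow> effective_application L (ind_hyp x t e) (cons_goal x h t e))"

text \<open>
  Nested induction on \<open>x\<close> and then \<open>y\<close>. If the two variables coincide, nothing is left to do
  induction on after the first induction, so the nested induction is an ordinary one.
\<close>

definition effective_nested_induction ::
  "'o language \<Rightarrow> (vname \<rightharpoonup> ty) \<Rightarrow> vname \<Rightarrow> vname \<Rightarrow> 'o equation \<Rightarrow> bool" where
  "effective_nested_induction L \<Gamma> x y e \<longleftrightarrow>
     (if x = y then effective_induction L \<Gamma> x e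
      else inductable \<Gamma> x e \<and>
        (\<forall>h t. fresh_pair h t e \<longrightarrow>
          (\<exists>g\<^sub>1 g\<^sub>2. (reduces L)\<^sup>*\<^sup>* (cons_goal x h t e) g\<^sub>1 \<and> rewrites_by (ind_hyp x t e) g\<^sub>1 g\<^sub>2 \<and>
             effective_induction L (\<Gamma>(h \<mapsto> TInt, t \<mapsto> TList)) y g\<^sub>2)))"

definition induction_friendly :: "'o language \<Rightarrow> 'o equation set \<Rightarrow> bool" where
  "induction_friendly L E \<longleftrightarrow>
     (\<forall>\<Gamma> e. well_typed L \<Gamma> e \<and> e \<in> E \<longrightarrow> (\<exists>x. effective_induction L \<Gamma> x e))"

text \<open>
  The schema of a CSR allows \<open>comb\<close> to ignore the result of the recursive call, as in the function
  returning the head of a list. Such a function is defined by a case distinction rather than by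
  recursion: after one reduction of a call no recursive call is left for an inductive hypothesis
  to apply to. The equation forms below are about CSRs that do recurse; all other CSRs may still
  occur anywhere in a program.
\<close>

definition recurses :: "'o language \<Rightarrow> nat \<Rightarrow> bool" where
  "recurses L f \<longleftrightarrow> Rec \<in> vars (comb (csrs L ! f))"

text \<open>
  In both forms the variables \<open>v_1, ..., v_k\<close> of a call are \<open>us @ [x]\<close>, with \<open>x\<close> in the recursive
  position.
\<close>

definition form1 :: "'o language \<Rightarrow> 'o equation set" where
  "form1 L = {e. \<exists>f us x p.
     (e = (Call f (map Var (us @ [x])), p) \<or> e = (p, Call f (map Var (us @ [x])))) \<and>
     recurses L f \<and> distinct (us @ [x]) \<and> vars p \<subseteq> set (us @ [x]) \<and>
     (x \<in> vars p \<longrightarrow>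
       (\<exists>g qs. Call g (qs @ [Var x]) \<in> subprogs p \<and> recurses L g \<and> (\<forall>q\<in>set qs. x \<notin> vars q)))}"

definition form2 :: "'o language \<Rightarrow> vname \<Rightarrow> vname \<Rightarrow> 'o equation set" where
  "form2 L x x' = {e. \<exists>f us f' us'.
     e = (Call f (map Var (us @ [x])), Call f' (map Var (us' @ [x']))) \<and>
     recurses L f \<and> recurses L f' \<and> length us = length us' \<and>
     distinct (us @ [x]) \<and> distinct (us' @ [x'])}"

end

theory Submission
  imports Defs
begin

text \<open>
  Call \<open>c = f p_1 ... p_(k-1) x\<close> recursive in \<open>x\<close> if \<open>f\<close> recurses and \<open>x\<close> does not occur in the
  \<open>p_i\<close>. Then \<open>c[cons h t]\<close> contracts to a program containing \<open>c[t]\<close>. Consider an equation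
  \<open>c = p\<close>. If \<open>x\<close> does not occur in \<open>p\<close>, then contracting the left side and rewriting the whole
  right side by the inductive hypothesis \<open>c[t] = p\<close> leaves \<open>c[t]\<close> on both sides. If \<open>p\<close> contains a
  call \<open>c'\<close> recursive in \<open>x\<close>, then contracting both calls exposes \<open>c'[t]\<close> on the right, and
  rewriting \<open>c[t]\<close> to \<open>p[t]\<close> creates another copy of \<open>c'[t]\<close> on the left. For the nested induction,
  the outer step copies the right side, with \<open>t\<close> for \<open>x\<close>, into the left side; the resulting equation
  is again of the shape just treated, read from right to left.
\<close>

lemma finite_vars: "finite (vars p)"
  by (induction p) auto

lemma subst_cong: "(\<And>v. v \<in> vars p \<Longrightarrow> \<sigma> v = \<tau> v) \<Longrightarrow> subst \<sigma> p = subst \<tau> p"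
  by (induction p) auto

lemma subst_Var [simp]: "subst Var p = p"
  by (induction p) (auto intro: map_idI)

lemma subst_upd_idle: "x \<notin> vars p \<Longrightarrow> subst (Var(x := s)) p = p"
  using subst_cong[of p "Var(x := s)" Var] by (metis fun_upd_other subst_Var)

lemma vars_subst: "vars (subst \<sigma> p) = (\<Union>v\<in>vars p. vars (\<sigma> v))"
  by (induction p) auto

lemma subprogs_arg: "s \<in> set (args p) \<Longrightarrow> s \<in> subprogs p"
  by (meson subprogs.intros)

lemma subprogs_trans: "s \<in> subprogs q \<Longrightarrow> q \<in> subprogs p \<Longrightarrow> s \<in> subprogs p"
  by (induction rule: subprogs.induct) (auto intro: subprogs.intros)

lemma args_subst: "s \<in> set (args p) \<Longrightarrow> subst \<sigma> s \<in> set (args (subst \<sigma> p))"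
  by (cases p) auto

lemma subprogs_subst: "s \<in> subprogs p \<Longrightarrow> subst \<sigma> s \<in> subprogs (subst \<sigma> p)"
  by (induction rule: subprogs.induct) (auto intro: subprogs.intros args_subst)

lemma subprogs_of_arg: "q \<in> set (args p) \<Longrightarrow> s \<in> subprogs q \<Longrightarrow> s \<in> subprogs p"
  using subprogs_arg subprogs_trans by blast

lemma Var_in_subprogs: "v \<in> vars p \<Longrightarrow> Var v \<in> subprogs p"
proof (induction p)
  case (PCons p q)
  then show ?case
    using subprogs_of_arg[of p "PCons p q"] subprogs_of_arg[of q "PCons p q"] by auto
qed (auto intro: subprogs.intros subprogs_of_arg[where p = "Op _ _"]
    subprogs_of_arg[where p = "Call _ _"])

lemma subst_var_in_subprogs: "v \<in> vars p \<Longrightarrow> \<sigma> v \<in> subprogs (subst \<sigma> p)"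
  using subprogs_subst[OF Var_in_subprogs, of v p \<sigma>] by simp

lemma in_context_arg:
  assumes "s \<in> set (args q)" "in_context R s c"
  shows "\<exists>q'. in_context R q q' \<and> c \<in> subprogs q'"
proof (cases q)
  case (Op a ps)
  with assms obtain as bs where "ps = as @ s # bs" by (auto dest: split_list)
  with Op assms show ?thesis
    by (intro exI[of _ "Op a (as @ c # bs)"]) (auto intro: in_context.intros subprogs_arg)
next
  case (PCons p p')
  with assms show ?thesis
    using in_context.intros(3)[of R p c p'] in_context.intros(4)[of R p' c p]
      subprogs_arg[of c "PCons c p'"] subprogs_arg[of c "PCons p c"] by auto
next
  case (Call f ps)
  with assms obtain as bs where "ps = as @ s # bs" by (auto dest: split_list)
  with Call assms show ?thesis
    by (intro exI[of _ "Call f (as @ c # bs)"]) (auto intro: in_context.intros subprogs_arg)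
qed (use assms in auto)

lemma in_context_in_context_subprogs:
  "s \<in> subprogs p \<Longrightarrow> in_context R s c \<Longrightarrow> \<exists>p'. in_context R p p' \<and> c \<in> subprogs p'"
proof (induction arbitrary: c rule: subprogs.induct)
  case 1
  then show ?case by (auto intro: subprogs.intros)
next
  case (2 q s)
  then show ?case by (meson in_context_arg subprogs_trans)
qed

lemma in_context_subprogs:
  assumes "s \<in> subprogs p" "R s c"
  obtains p' where "in_context R p p'" "c \<in> subprogs p'"
  using in_context_in_context_subprogs[OF assms(1) in_context.intros(1), of R c] assms(2) by blast

lemma has_type_args: "has_type L \<Gamma> p \<tau> \<Longrightarrow> s \<in> set (args p) \<Longrightarrow> \<exists>\<tau>. has_type L \<Gamma> s \<tau>"
  by (erule has_type.cases) (fastforce simp: list_all2_conv_all_nth in_set_conv_nth)+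

lemma has_type_subprogs: "s \<in> subprogs p \<Longrightarrow> has_type L \<Gamma> p \<tau> \<Longrightarrow> \<exists>\<tau>. has_type L \<Gamma> s \<tau>"
  by (induction rule: subprogs.induct) (use has_type_args in blast)+

lemma has_type_Call_Var:
  assumes "has_type L \<Gamma> (Call f (ps @ [Var x])) \<tau>"
  shows "f < length (csrs L)" "length ps = length (params (csrs L ! f))" "\<Gamma> x = Some TList"
proof -
  from assms have "f < length (csrs L)"
    and *: "list_all2 (has_type L \<Gamma>) (ps @ [Var x]) (params (csrs L ! f) @ [TList])"
    by (auto elim: has_type.cases)
  from * have "length ps = length (params (csrs L ! f))"
    by (auto dest: list_all2_lengthD)
  moreover from this * have "has_type L \<Gamma> (Var x) TList"
    by (simp add: list_all2_append)
  ultimately show "length ps = length (params (csrs L ! f))" "\<Gamma> x = Some TList"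
    by (auto elim: has_type.cases)
  show "f < length (csrs L)" by fact
qed

lemma exists_fresh: "\<exists>z. z \<notin> eq_vars e"
  unfolding eq_vars_def
  by (rule ex_new_if_finite) (auto simp: infinite_UNIV_listI finite_vars)

lemma in_equation_swap: "in_equation R e e' \<Longrightarrow> in_equation R (prod.swap e) (prod.swap e')"
  by (induction rule: in_equation.induct) (auto intro: in_equation.intros)

lemma reduces_swap:
  "(reduces L)\<^sup>*\<^sup>* e e' \<Longrightarrow> (reduces L)\<^sup>*\<^sup>* (prod.swap e) (prod.swap e')"
  by (induction rule: rtranclp_induct) (auto intro: rtranclp.rtrancl_into_rtrancl in_equation_swap)

lemma rewrites_by_swap:
  "rewrites_by hyp e e' \<Longrightarrow> rewrites_by (prod.swap hyp) (prod.swap e) (prod.swap e')"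
proof -
  have "(\<lambda>p q. (p, q) = prod.swap hyp \<or> (q, p) = prod.swap hyp)
      = (\<lambda>p q. (p, q) = hyp \<or> (q, p) = hyp)"
    by (cases hyp) auto
  then show "rewrites_by hyp e e' \<Longrightarrow> ?thesis"
    unfolding rewrites_by_def by (simp add: in_equation_swap)
qed

lemma eq_vars_swap [simp]: "eq_vars (prod.swap e) = eq_vars e"
  by (auto simp: eq_vars_def)

lemma generalizes_swap: "generalizes e e' \<Longrightarrow> generalizes (prod.swap e) (prod.swap e')"
  unfolding generalizes_def fst_swap snd_swap eq_vars_swap by (metis swap_simp)

lemma effective_application_swap:
  "effective_application L hyp goal \<Longrightarrow>
    effective_application L (prod.swap hyp) (prod.swap goal)"
  unfolding effective_application_def
  by (meson reduces_swap rewrites_by_swap generalizes_swap)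

lemma eq_subst_swap: "eq_subst x p (prod.swap e) = prod.swap (eq_subst x p e)"
  by (simp add: eq_subst_def)

lemma effective_induction_swap:
  "effective_induction L \<Gamma> x e \<Longrightarrow> effective_induction L \<Gamma> x (prod.swap e)"
  unfolding effective_induction_def inductable_def fresh_pair_def eq_subst_swap
  by (auto intro: effective_application_swap)

lemma effective_applicationI:
  assumes "(reduces L)\<^sup>*\<^sup>* goal g" "rewrites_by hyp g (l, r)"
    and "non_leaf s" "s \<in> subprogs l" "s \<in> subprogs r"
  shows "effective_application L hyp goal"
proof -
  obtain z where "z \<notin> eq_vars (l, r)"
    using exists_fresh by blast
  then have "generalizes (l, r) (replace s z l, replace s z r)"
    unfolding generalizes_def using assms(3-5) by auto
  then show ?thesis
    unfolding effective_application_def using assms(1,2) by blast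
qed

inductive recursive_call :: "'o language \<Rightarrow> vname \<Rightarrow> ('o, vname) prog \<Rightarrow> bool" for L x where
  "f < length (csrs L) \<Longrightarrow> length ps = length (params (csrs L ! f)) \<Longrightarrow> recurses L f \<Longrightarrow>
    \<forall>p\<in>set ps. x \<notin> vars p \<Longrightarrow> recursive_call L x (Call f (ps @ [Var x]))"

lemma recursive_call_vars: "recursive_call L x c \<Longrightarrow> x \<in> vars c"
  by (auto elim: recursive_call.cases)

lemma recursive_call_non_leaf: "recursive_call L x c \<Longrightarrow> non_leaf (subst \<sigma> c)"
  by (auto elim: recursive_call.cases)

lemma recursive_call_typed:
  assumes "has_type L \<Gamma> (Call f (ps @ [Var x])) \<tau>" "recurses L f" "\<forall>p\<in>set ps. x \<notin> vars p"
  shows "recursive_call L x (Call f (ps @ [Var x]))"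
  using assms by (intro recursive_call.intros has_type_Call_Var)

lemma recursive_call_subst:
  assumes "recursive_call L y c" "\<sigma> y = Var y" "\<And>v. v \<noteq> y \<Longrightarrow> y \<notin> vars (\<sigma> v)"
  shows "recursive_call L y (subst \<sigma> c)"
  using assms by (auto elim!: recursive_call.cases intro!: recursive_call.intros simp: vars_subst)
    metis

lemma recursive_call_unfold:
  assumes "recursive_call L x c"
  obtains d where "contracts L (subst (Var(x := PCons ph pt)) c) d"
    "subst (Var(x := pt)) c \<in> subprogs d"
  using assms
proof cases
  case (1 f ps)
  let ?\<sigma> = "\<lambda>v. case v of Arg i \<Rightarrow> ps ! i | Head \<Rightarrow> ph | Rec \<Rightarrow> Call f (ps @ [pt])"
  have c: "subst (Var(x := s)) c = Call f (ps @ [s])" for s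
    using 1 by (auto intro!: map_idI subst_upd_idle)
  have "contracts L (Call f (ps @ [PCons ph pt])) (subst ?\<sigma> (comb (csrs L ! f)))"
    using 1 by (intro contracts.intros)
  moreover have "?\<sigma> Rec \<in> subprogs (subst ?\<sigma> (comb (csrs L ! f)))"
    using 1 unfolding recurses_def by (intro subst_var_in_subprogs)
  ultimately show thesis
    using that by (simp add: c)
qed

lemma effective_induction_recursive_call:
  assumes c: "recursive_call L x c" and x: "\<Gamma> x = Some TList"
    and p: "x \<in> vars p \<Longrightarrow> \<exists>c'\<in>subprogs p. recursive_call L x c'"
  shows "effective_induction L \<Gamma> x (c, p)"
proof -
  have "effective_application L (ind_hyp x t (c, p)) (cons_goal x h t (c, p))" for h t
  proof -
    let ?C = "subst (Var(x := PCons (Var h) (Var t)))" and ?T = "subst (Var(x := Var t))"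
    let ?R = "\<lambda>a b. (a, b) = (?T c, ?T p) \<or> (b, a) = (?T c, ?T p)"
    have goal: "cons_goal x h t (c, p) = (?C c, ?C p)" and hyp: "ind_hyp x t (c, p) = (?T c, ?T p)"
      by (simp_all add: eq_subst_def)
    obtain d where d: "contracts L (?C c) d" "?T c \<in> subprogs d"
      using recursive_call_unfold[OF c] by blast
    then have red: "(reduces L)\<^sup>*\<^sup>* (?C c, ?C p) (d, ?C p)"
      by (auto intro: in_equation.intros in_context.intros)
    show ?thesis
    proof (cases "x \<in> vars p")
      case False
      then have "?C p = ?T p"
        by (simp add: subst_upd_idle)
      then have "rewrites_by (?T c, ?T p) (d, ?C p) (d, ?T c)"
        unfolding rewrites_by_def by (auto intro: in_equation.intros in_context.intros)
      with red show ?thesis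
        unfolding goal hyp using d(2) recursive_call_non_leaf[OF c]
        by (blast intro: effective_applicationI subprogs.intros)
    next
      case True
      then obtain c' where c': "c' \<in> subprogs p" "recursive_call L x c'"
        using p by blast
      obtain d' where d': "contracts L (?C c') d'" "?T c' \<in> subprogs d'"
        using recursive_call_unfold[OF c'(2)] by blast
      obtain p' where p': "in_context (contracts L) (?C p) p'" "d' \<in> subprogs p'"
        using in_context_subprogs[where R = "contracts L", OF subprogs_subst[OF c'(1)] d'(1)] .
      obtain l where l: "in_context ?R d l" "?T p \<in> subprogs l"
        using in_context_subprogs[where R = ?R, OF d(2)] by blast
      have "(reduces L)\<^sup>*\<^sup>* (?C c, ?C p) (d, p')"
        using red in_equation.intros(2)[OF p'(1)] by (rule rtranclp.rtrancl_into_rtrancl)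
      moreover have "rewrites_by (?T c, ?T p) (d, p') (l, p')"
        unfolding rewrites_by_def using l(1) by (rule in_equation.intros)
      moreover have "?T c' \<in> subprogs l" "?T c' \<in> subprogs p'"
        using subprogs_subst[OF c'(1)] subprogs_trans l(2) d'(2) p'(2) by blast+
      ultimately show ?thesis
        unfolding goal hyp using recursive_call_non_leaf[OF c'(2)]
        by (blast intro: effective_applicationI)
    qed
  qed
  then show ?thesis
    unfolding effective_induction_def inductable_def
    using x recursive_call_vars[OF c] by (auto simp: eq_vars_def)
qed

lemma effective_nested_induction_recursive_calls:
  assumes c: "recursive_call L x c" "\<Gamma> x = Some TList"
    and c': "recursive_call L x' c'" "\<Gamma> x' = Some TList"
  shows "effective_nested_induction L \<Gamma> x x' (c, c')"
proof (cases "x = x'")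
  case True
  with assms have "effective_induction L \<Gamma> x (c, c')"
    by (intro effective_induction_recursive_call) (auto intro: subprogs.intros)
  with True show ?thesis
    by (simp add: effective_nested_induction_def)
next
  case False
  have "\<exists>g\<^sub>1 g\<^sub>2. (reduces L)\<^sup>*\<^sup>* (cons_goal x h t (c, c')) g\<^sub>1 \<and>
      rewrites_by (ind_hyp x t (c, c')) g\<^sub>1 g\<^sub>2 \<and>
      effective_induction L (\<Gamma>(h \<mapsto> TInt, t \<mapsto> TList)) x' g\<^sub>2"
    if fresh: "fresh_pair h t (c, c')" for h t
  proof -
    let ?C = "subst (Var(x := PCons (Var h) (Var t)))" and ?T = "subst (Var(x := Var t))"
    let ?R = "\<lambda>a b. (a, b) = (?T c, ?T c') \<or> (b, a) = (?T c, ?T c')"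
    have neq: "x' \<noteq> h" "x' \<noteq> t"
      using fresh recursive_call_vars[OF c'(1)] by (auto simp: fresh_pair_def eq_vars_def)
    obtain d where d: "contracts L (?C c) d" "?T c \<in> subprogs d"
      using recursive_call_unfold[OF c(1)] by blast
    obtain l where l: "in_context ?R d l" "?T c' \<in> subprogs l"
      using in_context_subprogs[where R = ?R, OF d(2)] by blast
    have "recursive_call L x' (?C c')" "recursive_call L x' (?T c')"
      using False neq by (auto intro!: recursive_call_subst[OF c'(1)] split: if_splits)
    then have "effective_induction L (\<Gamma>(h \<mapsto> TInt, t \<mapsto> TList)) x' (?C c', l)"
      using c'(2) neq l(2) by (intro effective_induction_recursive_call) auto
    then have "effective_induction L (\<Gamma>(h \<mapsto> TInt, t \<mapsto> TList)) x' (l, ?C c')"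
      using effective_induction_swap by fastforce
    moreover have "(reduces L)\<^sup>*\<^sup>* (?C c, ?C c') (d, ?C c')"
      using d(1) by (auto intro: in_equation.intros in_context.intros)
    moreover have "rewrites_by (?T c, ?T c') (d, ?C c') (l, ?C c')"
      unfolding rewrites_by_def using l(1) by (rule in_equation.intros)
    ultimately show ?thesis
      unfolding eq_subst_def by auto
  qed
  then show ?thesis
    using False c(2) recursive_call_vars[OF c(1)]
    by (auto simp: effective_nested_induction_def inductable_def eq_vars_def)
qed

lemma induction_friendly_form1: "induction_friendly L (form1 L)"
  unfolding induction_friendly_def
proof (intro allI impI, elim conjE)
  fix \<Gamma> e
  assume typed: "well_typed L \<Gamma> e" and "e \<in> form1 L"
  then obtain f us x p where
    e: "e = (Call f (map Var us @ [Var x]), p) \<or> e = (p, Call f (map Var us @ [Var x]))"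
    and f: "recurses L f" "x \<notin> set us"
    and p: "x \<in> vars p \<Longrightarrow> \<exists>g qs. Call g (qs @ [Var x]) \<in> subprogs p \<and> recurses L g \<and>
      (\<forall>q\<in>set qs. x \<notin> vars q)"
    unfolding form1_def map_append list.map distinct_append
    by (elim CollectE exE conjE) (rule that, auto)
  let ?c = "Call f (map Var us @ [Var x]) :: ('a, vname) prog"
  from typed e obtain \<tau> where \<tau>: "has_type L \<Gamma> ?c \<tau>" "has_type L \<Gamma> p \<tau>"
    unfolding well_typed_def by auto
  have c: "recursive_call L x ?c"
    using \<tau>(1) f by (intro recursive_call_typed) auto
  have "\<exists>c'\<in>subprogs p. recursive_call L x c'" if "x \<in> vars p"
    using p[OF that] has_type_subprogs[OF _ \<tau>(2)] recursive_call_typed by metis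
  then have "effective_induction L \<Gamma> x (?c, p)"
    using c has_type_Call_Var(3)[OF \<tau>(1)] by (intro effective_induction_recursive_call)
  with e show "\<exists>x. effective_induction L \<Gamma> x e"
    using effective_induction_swap by fastforce
qed

lemma effective_nested_induction_form2:
  assumes "well_typed L \<Gamma> e" "e \<in> form2 L x x'"
  shows "effective_nested_induction L \<Gamma> x x' e"
proof -
  obtain f us f' us' where
    e: "e = (Call f (map Var us @ [Var x]), Call f' (map Var us' @ [Var x']))"
    and f: "recurses L f" "x \<notin> set us" and f': "recurses L f'" "x' \<notin> set us'"
    using assms(2) unfolding form2_def by auto
  obtain \<tau> where \<tau>: "has_type L \<Gamma> (Call f (map Var us @ [Var x])) \<tau>"
    "has_type L \<Gamma> (Call f' (map Var us' @ [Var x'])) \<tau>"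
    using assms(1) unfolding well_typed_def e by auto
  show ?thesis
    unfolding e using \<tau>[THEN has_type_Call_Var(3)] f f'
    by (intro effective_nested_induction_recursive_calls recursive_call_typed[OF \<tau>(1)]
          recursive_call_typed[OF \<tau>(2)]) auto
qed

theorem theorem1:
  fixes L :: "'o language"
  assumes "wf_language L"
  shows "induction_friendly L (form1 L) \<and>
    (\<forall>\<Gamma> x x' e. well_typed L \<Gamma> e \<and> e \<in> form2 L x x' \<longrightarrow> effective_nested_induction L \<Gamma> x x' e)"
  using induction_friendly_form1 effective_nested_induction_form2 by blast

end
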